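(* For any three elements $x,y,z\in\mathcal R$, we have $(x\oplus y)\otimes z\sim(x\otimes z)\oplus(y\otimes z)$.
   Context: $\mathbb N=\{1,2,3,\dots\}$ and $\mathcal Z_{10}=\{0,1,\dots,9\}$. $\mathcal R$ is the set of all formal decimals $x=x_0.x_1x_2x_3\cdots$ with $x_0\in\mathbb Z$ and $x_k\in\mathcal Z_{10}$ for $k\in\mathbb N$; two elements are equal iff all their digits agree. For $k\in\mathbb N$, $[x]_k=\sum_{i=0}^k x_i10^{-i}\in\mathbb Q$. Order on $\mathcal R$: $x\preceq y$ iff $[x]_k\le [y]_k$ for all $k\in\mathbb N$. Every nonempty bounded above (below) subset of $(\mathcal R,\preceq)$ has a supremum (infimum). $x\sim y$ ("no gap") means that there is no $z\in\mathcal R\setminus\{x,y\}$ lying strictly between $x$ and $y$ with respect to $\preceq$; $\sim$ is an equivalence relation. $\mathbb Q$ is regarded as a subset of $\mathcal R$ via long division: $\alpha=q/p$ ($p\in\mathbb N$, $q\in\mathbb Z$) is identified with $\alpha_0.\alpha_1\alpha_2\cdots$, where $\alpha_0=\lfloor q/p\rfloor$, $\beta_0=q-\alpha_0p$, $\alpha_{k+1}=\lfloor 10\beta_k/p\rfloor$, $\beta_{k+1}=10\beta_k-\alpha_{k+1}p$. For a bounded sequence $\{x^{(n)}\}_{n\in\mathbb N}$ in $\mathcal R$: $\overline{\mathrm{LIMIT}}(\{x^{(n)}\})=\inf\{\sup\{x^{(k)}: k\ge n\}: n\in\mathbb N\}$ and $\underline{\mathrm{LIMIT}}(\{x^{(n)}\})=\sup\{\inf\{x^{(k)}: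 k\ge n\}: n\in\mathbb N\}$; if they are equal, the common value is denoted $\mathrm{LIMIT}(\{x^{(n)}\})$. It exists for bounded monotone sequences. Addition: $x\oplus y=\mathrm{LIMIT}(\{[x]_k+[y]_k\}_{k\in\mathbb N})$, the sums $[x]_k+[y]_k$ being taken in $\mathbb Q$. Additive inverse map: $\Psi(x_0.x_1x_2x_3\cdots)=(-1-x_0).(9-x_1)(9-x_2)(9-x_3)\cdots$; $\Psi^{(k)}$ is the $k$-fold composite of $\Psi$ ($\Psi^{(0)}=\mathrm{id}$). Absolute value: $\|x\|=\max\{x,\Psi(x)\}$ (with respect to $\preceq$). Sign: $\mathrm{sign}(x)=0$ if $x\succeq 0.000000\cdots$ and $\mathrm{sign}(x)=1$ if $x\preceq(-1).999999\cdots$. Multiplication: $x\otimes y=\Psi^{(\mathrm{sign}(x)+\mathrm{sign}(y))}\big(\mathrm{LIMIT}(\{[\|x\|]_k\cdot[\|y\|]_k\}_{k\in\mathbb N})\big)$, the products $[\|x\|]_k\cdot[\|y\|]_k$ being taken in $\mathbb Q$. *)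

theory Defs
  imports Complex_Main
begin

section \<open>Formal decimals\<close>

text \<open>
  A formal decimal is its digit sequence: the digit at index 0 is the integer part \<open>x\<^sub>0\<close>
  (any integer), the digits at indices \<open>k \<ge> 1\<close> lie in \<open>{0..9}\<close>. No identification of
  decimals ending in \<open>999\<dots>\<close> is made.
\<close>

typedef decimal = "{d :: nat \<Rightarrow> int. \<forall>k\<ge>1. d k \<in> {0..9}}"
  morphisms digit Decimal
  by (rule exI[of _ "\<lambda>_. 0"]) simp

setup_lifting type_definition_decimal

lemma decimal_eqI: "(\<And>k. digit x k = digit y k) \<Longrightarrow> x = y"
  by (metis digit_inject ext)

lemma digit_bounds: "k \<ge> 1 \<Longrightarrow> 0 \<le> digit x k \<and> digit x k \<le> 9"
  using digit[of x] by auto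

definition trunc :: "decimal \<Rightarrow> nat \<Rightarrow> rat" where
  "trunc x k = (\<Sum>i=0..k. of_int (digit x i) / 10 ^ i)"

text \<open>The integer \<open>10\<^sup>k [x]\<^sub>k\<close>, used only to establish the order properties below.\<close>

primrec itrunc :: "decimal \<Rightarrow> nat \<Rightarrow> int" where
  "itrunc x 0 = digit x 0"
| "itrunc x (Suc k) = 10 * itrunc x k + digit x (Suc k)"

lemma trunc_itrunc: "trunc x k = of_int (itrunc x k) / 10 ^ k"
  by (induction k) (simp_all add: trunc_def field_simps)

lemma trunc_le_iff: "trunc x k \<le> trunc y k \<longleftrightarrow> itrunc x k \<le> itrunc y k"
  by (simp add: trunc_itrunc divide_le_cancel)

lemma itrunc_Suc_div: "itrunc x (Suc k) div 10 = itrunc x k"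
  using digit_bounds[of "Suc k" x] by simp

lemma itrunc_SucD: "itrunc x (Suc k) \<le> itrunc y (Suc k) \<Longrightarrow> itrunc x k \<le> itrunc y k"
  by (metis itrunc_Suc_div zdiv_mono1 zero_less_numeral)

lemma itrunc_SucD': "itrunc x k < itrunc y k \<Longrightarrow> itrunc x (Suc k) < itrunc y (Suc k)"
  using itrunc_SucD[of y k x] by linarith

lemma itrunc_less_mono: "k \<le> j \<Longrightarrow> itrunc x k < itrunc y k \<Longrightarrow> itrunc x j < itrunc y j"
  by (induction rule: dec_induct) (auto intro: itrunc_SucD' simp del: itrunc.simps)

lemma itrunc_inject: "(\<And>k. itrunc x k = itrunc y k) \<Longrightarrow> x = y"
proof (rule decimal_eqI)
  fix k assume *: "\<And>k. itrunc x k = itrunc y k"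
  show "digit x k = digit y k"
    using *[of k] *[of "k - 1"] by (cases k) auto
qed

section \<open>The order\<close>

instantiation decimal :: linorder
begin

definition less_eq_decimal :: "decimal \<Rightarrow> decimal \<Rightarrow> bool" where
  "x \<le> y \<longleftrightarrow> (\<forall>k\<ge>1. trunc x k \<le> trunc y k)"

definition less_decimal :: "decimal \<Rightarrow> decimal \<Rightarrow> bool" where
  "(x :: decimal) < y \<longleftrightarrow> x \<le> y \<and> x \<noteq> y"

lemma le_decimal_iff: "(x :: decimal) \<le> y \<longleftrightarrow> (\<forall>k. itrunc x k \<le> itrunc y k)"
proof
  assume *: "x \<le> y"
  show "\<forall>k. itrunc x k \<le> itrunc y k"
  proof
    fix k
    have "itrunc x (Suc k) \<le> itrunc y (Suc k)"
      using * by (simp add: less_eq_decimal_def trunc_le_iff del: itrunc.simps)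
    then show "itrunc x k \<le> itrunc y k" by (rule itrunc_SucD)
  qed
qed (simp add: less_eq_decimal_def trunc_le_iff)

instance
proof
  fix x y z :: decimal
  show antisym: "x \<le> y \<Longrightarrow> y \<le> x \<Longrightarrow> x = y" for x y :: decimal
    by (rule itrunc_inject) (simp add: le_decimal_iff eq_iff)
  show "x < y \<longleftrightarrow> x \<le> y \<and> \<not> y \<le> x"
    using antisym by (auto simp: less_decimal_def)
  show "x \<le> x" by (simp add: le_decimal_iff)
  show "x \<le> y \<Longrightarrow> y \<le> z \<Longrightarrow> x \<le> z"
    unfolding le_decimal_iff by (meson order_trans)
  show "x \<le> y \<or> y \<le> x"
  proof (rule ccontr)
    assume "\<not> (x \<le> y \<or> y \<le> x)"
    then obtain k j where "itrunc y k < itrunc x k" "itrunc x j < itrunc y j"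
      by (auto simp: le_decimal_iff not_le)
    then show False
      using itrunc_less_mono[of k "max k j" y x] itrunc_less_mono[of j "max k j" x y]
      by (meson max.cobounded1 max.cobounded2 not_less_iff_gr_or_eq)
  qed
qed

end

lemma decimal_Sup_exists:
  fixes X :: "decimal set"
  assumes "X \<noteq> {}" and "\<And>x. x \<in> X \<Longrightarrow> x \<le> b"
  shows "\<exists>s. (\<forall>x\<in>X. x \<le> s) \<and> (\<forall>c. (\<forall>x\<in>X. x \<le> c) \<longrightarrow> s \<le> c)"
proof -
  have "\<exists>m. (\<exists>x\<in>X. m = itrunc x k) \<and> (\<forall>x\<in>X. itrunc x k \<le> m)" for k
  proof -
    obtain x0 where x0: "x0 \<in> X" using assms(1) by blast
    define A where "A = {itrunc x0 k..itrunc b k} \<inter> (\<lambda>x. itrunc x k) ` X"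
    have le: "itrunc x k \<le> itrunc b k" if "x \<in> X" for x
      using assms(2)[OF that] by (simp add: le_decimal_iff)
    have fin: "finite A" unfolding A_def by simp
    have ne: "itrunc x0 k \<in> A" unfolding A_def using x0 le[OF x0] by auto
    have "itrunc x k \<le> Max A" if "x \<in> X" for x
    proof (cases "itrunc x0 k \<le> itrunc x k")
      case True
      then have "itrunc x k \<in> A" unfolding A_def using that le[OF that] by auto
      then show ?thesis using fin by simp
    next
      case False
      then show ?thesis using Max_ge[OF fin ne] by linarith
    qed
    moreover have "Max A \<in> A" using fin ne Max_in by blast
    ultimately show ?thesis unfolding A_def by auto
  qed
  then obtain M where M1: "\<And>k. \<exists>x\<in>X. M k = itrunc x k"
    and M2: "\<And>k x. x \<in> X \<Longrightarrow> itrunc x k \<le> M k" by metis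
  have M_Suc: "M (Suc k) div 10 = M k" for k
  proof (rule antisym)
    obtain x where "x \<in> X" "M (Suc k) = itrunc x (Suc k)" using M1 by blast
    then show "M (Suc k) div 10 \<le> M k" using M2 by (simp add: itrunc_Suc_div del: itrunc.simps)
    obtain y where y: "y \<in> X" "M k = itrunc y k" using M1 by blast
    then show "M k \<le> M (Suc k) div 10"
      using zdiv_mono1[OF M2[of y "Suc k"], of 10] by (simp add: itrunc_Suc_div del: itrunc.simps)
  qed
  define d where "d = (\<lambda>k. if k = 0 then M 0 else M k mod 10)"
  define s where "s = Decimal d"
  have "d \<in> {d :: nat \<Rightarrow> int. \<forall>k\<ge>1. d k \<in> {0..9}}"
  proof -
    have "0 \<le> M k mod 10" "M k mod 10 \<le> 9" for k by presburger+
    then show ?thesis by (simp add: d_def)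
  qed
  then have digit_s: "digit s = d" unfolding s_def by (rule Decimal_inverse)
  have itr: "itrunc s k = M k" for k
  proof (induction k)
    case 0
    then show ?case by (simp add: digit_s d_def)
  next
    case (Suc k)
    have "itrunc s (Suc k) = 10 * (M (Suc k) div 10) + M (Suc k) mod 10"
      by (simp add: Suc digit_s d_def M_Suc)
    then show ?case by simp
  qed
  show ?thesis
  proof (intro exI conjI ballI allI impI)
    show "x \<le> s" if "x \<in> X" for x using M2[OF that] by (simp add: le_decimal_iff itr)
    show "s \<le> c" if "\<forall>x\<in>X. x \<le> c" for c
      unfolding le_decimal_iff itr
    proof
      fix k
      obtain x where "x \<in> X" "M k = itrunc x k" using M1 by blast
      then show "M k \<le> itrunc c k" using that by (simp add: le_decimal_iff)
    qed
  qed
qed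

lemma decimal_Inf_exists:
  fixes X :: "decimal set"
  assumes "X \<noteq> {}" and "\<And>x. x \<in> X \<Longrightarrow> b \<le> x"
  shows "\<exists>s. (\<forall>x\<in>X. s \<le> x) \<and> (\<forall>c. (\<forall>x\<in>X. c \<le> x) \<longrightarrow> c \<le> s)"
proof -
  obtain x0 where x0: "x0 \<in> X" using assms(1) by blast
  have "\<exists>s. (\<forall>x\<in>{c. \<forall>x\<in>X. c \<le> x}. x \<le> s) \<and>
      (\<forall>c. (\<forall>x\<in>{c. \<forall>x\<in>X. c \<le> x}. x \<le> c) \<longrightarrow> s \<le> c)"
    by (rule decimal_Sup_exists[of _ x0]) (use assms x0 in auto)
  then show ?thesis by blast
qed

instantiation decimal :: conditionally_complete_linorder
begin

definition inf_decimal :: "decimal \<Rightarrow> decimal \<Rightarrow> decimal" where "inf_decimal = min"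
definition sup_decimal :: "decimal \<Rightarrow> decimal \<Rightarrow> decimal" where "sup_decimal = max"

definition Sup_decimal :: "decimal set \<Rightarrow> decimal" where
  "Sup (X :: decimal set) = (THE s. (\<forall>x\<in>X. x \<le> s) \<and> (\<forall>c. (\<forall>x\<in>X. x \<le> c) \<longrightarrow> s \<le> c))"

definition Inf_decimal :: "decimal set \<Rightarrow> decimal" where
  "Inf (X :: decimal set) = (THE s. (\<forall>x\<in>X. s \<le> x) \<and> (\<forall>c. (\<forall>x\<in>X. c \<le> x) \<longrightarrow> c \<le> s))"

lemma Sup_decimal_works:
  fixes X :: "decimal set"
  assumes "X \<noteq> {}" and "\<And>x. x \<in> X \<Longrightarrow> x \<le> b"
  shows "(\<forall>x\<in>X. x \<le> Sup X) \<and> (\<forall>c. (\<forall>x\<in>X. x \<le> c) \<longrightarrow> Sup X \<le> c)"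
  unfolding Sup_decimal_def
proof (rule theI')
  show "\<exists>!s. (\<forall>x\<in>X. x \<le> s) \<and> (\<forall>c. (\<forall>x\<in>X. x \<le> c) \<longrightarrow> s \<le> c)"
    using decimal_Sup_exists[OF assms] by (blast intro: order.antisym)
qed

lemma Inf_decimal_works:
  fixes X :: "decimal set"
  assumes "X \<noteq> {}" and "\<And>x. x \<in> X \<Longrightarrow> b \<le> x"
  shows "(\<forall>x\<in>X. Inf X \<le> x) \<and> (\<forall>c. (\<forall>x\<in>X. c \<le> x) \<longrightarrow> c \<le> Inf X)"
  unfolding Inf_decimal_def
proof (rule theI')
  show "\<exists>!s. (\<forall>x\<in>X. s \<le> x) \<and> (\<forall>c. (\<forall>x\<in>X. c \<le> x) \<longrightarrow> c \<le> s)"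
    using decimal_Inf_exists[OF assms] by (blast intro: order.antisym)
qed

instance
proof
  fix x y z :: decimal and X :: "decimal set"
  show "inf x y \<le> x" "inf x y \<le> y" "x \<le> y \<Longrightarrow> x \<le> z \<Longrightarrow> x \<le> inf y z"
    by (auto simp: inf_decimal_def)
  show "x \<le> sup x y" "y \<le> sup x y" "y \<le> x \<Longrightarrow> z \<le> x \<Longrightarrow> sup y z \<le> x"
    by (auto simp: sup_decimal_def)
  show "x \<in> X \<Longrightarrow> bdd_below X \<Longrightarrow> Inf X \<le> x"
    using Inf_decimal_works[of X] unfolding bdd_below_def by blast
  show "X \<noteq> {} \<Longrightarrow> (\<And>x. x \<in> X \<Longrightarrow> z \<le> x) \<Longrightarrow> z \<le> Inf X"
    using Inf_decimal_works[of X z] by blast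
  show "x \<in> X \<Longrightarrow> bdd_above X \<Longrightarrow> x \<le> Sup X"
    using Sup_decimal_works[of X] unfolding bdd_above_def by blast
  show "X \<noteq> {} \<Longrightarrow> (\<And>x. x \<in> X \<Longrightarrow> x \<le> z) \<Longrightarrow> Sup X \<le> z"
    using Sup_decimal_works[of X z] by blast
qed

end

definition no_gap :: "decimal \<Rightarrow> decimal \<Rightarrow> bool"  (infix \<open>\<sim>\<close> 50) where
  "x \<sim> y \<longleftrightarrow> \<not> (\<exists>z. z \<notin> {x, y} \<and> (x < z \<and> z < y \<or> y < z \<and> z < x))"

section \<open>Rational numbers as formal decimals\<close>

text \<open>Long division of \<open>q\<close> by \<open>p\<close>: the digits \<open>\<alpha>\<^sub>k\<close> and the remainders \<open>\<beta>\<^sub>k\<close>.\<close>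

fun ld_digit :: "int \<Rightarrow> int \<Rightarrow> nat \<Rightarrow> int"
  and ld_rem :: "int \<Rightarrow> int \<Rightarrow> nat \<Rightarrow> int" where
  "ld_digit q p 0 = q div p"
| "ld_digit q p (Suc k) = (10 * ld_rem q p k) div p"
| "ld_rem q p 0 = q - ld_digit q p 0 * p"
| "ld_rem q p (Suc k) = 10 * ld_rem q p k - ld_digit q p (Suc k) * p"

lemma ld_rem_bounds: "p > 0 \<Longrightarrow> 0 \<le> ld_rem q p k \<and> ld_rem q p k < p"
  by (cases k) (simp_all add: minus_div_mult_eq_mod)

lemma ld_digit_bounds:
  assumes "p > 0" "k \<ge> 1"
  shows "ld_digit q p k \<in> {0..9}"
proof -
  obtain j where k: "k = Suc j" using assms(2) by (cases k) auto
  have r: "0 \<le> ld_rem q p j" "ld_rem q p j < p" using ld_rem_bounds[OF assms(1)] by auto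
  have "(10 * ld_rem q p j) div p < 10"
  proof (rule ccontr)
    assume "\<not> (10 * ld_rem q p j) div p < 10"
    then have "10 * p \<le> (10 * ld_rem q p j) div p * p"
      using assms(1) by (intro mult_right_mono) auto
    also have "\<dots> \<le> 10 * ld_rem q p j"
      using assms(1) minus_mod_eq_div_mult[of "10 * ld_rem q p j" p]
        pos_mod_sign[of p "10 * ld_rem q p j"] by linarith
    finally show False using r by linarith
  qed
  moreover have "0 \<le> (10 * ld_rem q p j) div p"
    using r assms(1) by (simp add: pos_imp_zdiv_nonneg_iff)
  ultimately show ?thesis by (simp add: k)
qed

text \<open>
  The embedding is defined from the representation in lowest terms with positive denominator;
  \<open>decimal_of_rat_Fract\<close> below shows that any other fraction yields the same digits.
\<close>

lift_definition decimal_of_rat :: "rat \<Rightarrow> decimal" is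
  "\<lambda>r. ld_digit (fst (quotient_of r)) (snd (quotient_of r))"
  by (simp add: ld_digit_bounds quotient_of_denom_pos' del: atLeastAtMost_iff)

lemma ld_scale:
  assumes "c > 0"
  shows "ld_digit (c * q) (c * p) k = ld_digit q p k \<and> ld_rem (c * q) (c * p) k = c * ld_rem q p k"
proof (induction k)
  case 0
  then show ?case using assms by (simp add: algebra_simps)
next
  case (Suc k)
  have "(10 * (c * ld_rem q p k)) div (c * p) = (10 * ld_rem q p k) div p"
    using assms by (simp add: mult.left_commute[of 10 c])
  then show ?case using Suc by (simp add: algebra_simps)
qed

lemma decimal_of_rat_Fract:
  assumes "p > 0"
  shows "digit (decimal_of_rat (Fract q p)) k = ld_digit q p k"
proof -
  obtain a b where ab: "quotient_of (Fract q p) = (a, b)" by fastforce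
  have g: "gcd q p > 0" using assms by simp
  have "a = q div gcd q p" "b = p div gcd q p"
    using ab assms by (auto simp: quotient_of_Fract Rat.normalize_def Let_def)
  then have "q = gcd q p * a" "p = gcd q p * b" by simp_all
  then have "ld_digit q p k = ld_digit a b k" using ld_scale[OF g, of a b k] by simp
  then show ?thesis by (simp add: decimal_of_rat.rep_eq ab)
qed

section \<open>Limits\<close>

text \<open>
  Sequences are indexed by the positive integers: the value of a sequence at index 0 is ignored.
  \<open>LIMIT\<close> is meaningful only for bounded sequences whose upper and lower limits agree.
\<close>

definition LIMIT_sup :: "(nat \<Rightarrow> decimal) \<Rightarrow> decimal" where
  "LIMIT_sup s = (INF n\<in>{1..}. SUP k\<in>{n..}. s k)"

definition LIMIT_inf :: "(nat \<Rightarrow> decimal) \<Rightarrow> decimal" where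
  "LIMIT_inf s = (SUP n\<in>{1..}. INF k\<in>{n..}. s k)"

definition LIMIT :: "(nat \<Rightarrow> decimal) \<Rightarrow> decimal" where
  "LIMIT s = (THE l. LIMIT_sup s = l \<and> LIMIT_inf s = l)"

section \<open>Arithmetic\<close>

definition dadd :: "decimal \<Rightarrow> decimal \<Rightarrow> decimal"  (infixl \<open>\<oplus>\<close> 65) where
  "x \<oplus> y = LIMIT (\<lambda>k. decimal_of_rat (trunc x k + trunc y k))"

lift_definition Psi :: "decimal \<Rightarrow> decimal"  (\<open>\<Psi>\<close>) is
  "\<lambda>d k. if k = 0 then -1 - d 0 else 9 - d k"
  by auto

definition dabs :: "decimal \<Rightarrow> decimal"  (\<open>\<parallel>_\<parallel>\<close>) where
  "\<parallel>x\<parallel> = max x (\<Psi> x)"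

lift_definition dzero :: decimal is "\<lambda>_. 0" by simp

text \<open>The decimal \<open>(-1).999\<dots>\<close>, the immediate predecessor of \<open>0.000\<dots>\<close>.\<close>

lift_definition dneg_zero :: decimal is "\<lambda>k. if k = 0 then -1 else 9" by simp

lemma decimal_le_dneg_zero_iff: "x \<le> dneg_zero \<longleftrightarrow> \<not> dzero \<le> x"
proof -
  have z: "itrunc dzero k = 0" for k by (induction k) (simp_all add: dzero.rep_eq)
  have n: "itrunc dneg_zero k = -1" for k by (induction k) (simp_all add: dneg_zero.rep_eq)
  have "\<not> dzero \<le> x" if "x \<le> dneg_zero"
  proof
    assume "dzero \<le> x"
    with that have "dzero \<le> dneg_zero" by (rule order_trans[rotated])
    then have "itrunc dzero 0 \<le> itrunc dneg_zero 0" by (simp only: le_decimal_iff)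
    then show False by (simp only: z n)
  qed
  moreover have "x \<le> dneg_zero" if h: "\<not> dzero \<le> x"
  proof (rule ccontr)
    assume "\<not> x \<le> dneg_zero"
    then have "dneg_zero \<le> x" "dneg_zero \<noteq> x" by auto
    then obtain j where "itrunc dneg_zero j \<noteq> itrunc x j"
      using itrunc_inject by blast
    moreover have "itrunc dneg_zero j \<le> itrunc x j"
      using \<open>dneg_zero \<le> x\<close> by (simp only: le_decimal_iff)
    ultimately have "itrunc dneg_zero j < itrunc x j" by linarith
    then have "itrunc dneg_zero (max i j) < itrunc x (max i j)" for i
      by (rule itrunc_less_mono[OF max.cobounded2])
    moreover obtain i where "itrunc x i < itrunc dzero i"
      using h unfolding le_decimal_iff not_all not_le by blast
    then have "itrunc x (max i j) < itrunc dzero (max i j)"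
      by (rule itrunc_less_mono[OF max.cobounded1])
    moreover have "\<not> (-1 < m \<and> m < 0)" for m :: int by arith
    ultimately show False unfolding z n by meson
  qed
  ultimately show ?thesis by blast
qed

text \<open>
  By \<open>decimal_le_dneg_zero_iff\<close>, the second case below is exactly \<open>x \<le> (-1).999\<dots>\<close>.
\<close>

definition dsign :: "decimal \<Rightarrow> nat" where
  "dsign x = (if dzero \<le> x then 0 else 1)"

definition dmult :: "decimal \<Rightarrow> decimal \<Rightarrow> decimal"  (infixl \<open>\<otimes>\<close> 70) where
  "x \<otimes> y = (\<Psi> ^^ (dsign x + dsign y))
     (LIMIT (\<lambda>k. decimal_of_rat (trunc \<parallel>x\<parallel> k * trunc \<parallel>y\<parallel> k)))"

end

theory Submission
  imports Defs
begin

text \<open>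
  Each formal decimal has a real value, the limit of its truncations. Two decimals with equal
  values have no gap between them, since three decimals \<open>x < z < y\<close> have integer truncations
  differing by at least 2 at some position, which separates the values. The value map turns
  \<open>\<oplus>\<close>, \<open>\<otimes>\<close> into real addition and multiplication, so the claim reduces to
  distributivity in the reals.
\<close>

text \<open>Going through \<open>itrunc\<close> keeps the order facts about integer truncations
  directly applicable to the real approximations.\<close>

definition approx :: "decimal \<Rightarrow> nat \<Rightarrow> real" where
  "approx x k = of_int (itrunc x k) / 10 ^ k"

definition val :: "decimal \<Rightarrow> real" where
  "val x = lim (approx x)"

lemma of_rat_trunc: "of_rat (trunc x k) = approx x k"
  by (simp add: trunc_itrunc approx_def of_rat_divide of_rat_power)

lemma approx_le_Suc: "approx x k \<le> approx x (Suc k)"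
  using digit_bounds[of "Suc k" x] by (simp add: approx_def field_simps)

text \<open>Truncations increase, while truncations plus one unit in the last place decrease because
  digits are at most 9. The gap \<open>1 / 10 ^ k\<close> vanishes, so these nested bounds share one
  limit.\<close>

lemma approx_val:
  shows approx_tendsto: "approx x \<longlonglongrightarrow> val x"
    and approx_le_val: "approx x k \<le> val x"
    and val_le_approx: "val x \<le> approx x k + 1 / 10 ^ k"
proof -
  have "\<exists>l. ((\<forall>n. approx x n \<le> l) \<and> approx x \<longlonglongrightarrow> l) \<and>
      ((\<forall>n. l \<le> approx x n + 1 / 10 ^ n) \<and> (\<lambda>n. approx x n + 1 / 10 ^ n) \<longlonglongrightarrow> l)"
  proof (rule nested_sequence_unique)
    show "\<forall>n. approx x (Suc n) + 1 / 10 ^ Suc n \<le> approx x n + 1 / 10 ^ n"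
    proof
      fix n
      show "approx x (Suc n) + 1 / 10 ^ Suc n \<le> approx x n + 1 / 10 ^ n"
        using digit_bounds[of "Suc n" x] by (simp add: approx_def field_simps)
    qed
    have "(\<lambda>n. (1 / 10 :: real) ^ n) \<longlonglongrightarrow> 0" by (rule LIMSEQ_power_zero) simp
    from tendsto_minus[OF this]
    show "(\<lambda>n. approx x n - (approx x n + 1 / 10 ^ n)) \<longlonglongrightarrow> 0"
      by (simp add: power_one_over)
  qed (auto simp: approx_le_Suc)
  then obtain l where l: "\<And>n. approx x n \<le> l" "approx x \<longlonglongrightarrow> l"
      "\<And>n. l \<le> approx x n + 1 / 10 ^ n" by blast
  then have "val x = l" unfolding val_def by (intro limI)
  with l show "approx x \<longlonglongrightarrow> val x" "approx x k \<le> val x" "val x \<le> approx x k + 1 / 10 ^ k"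
    by auto
qed

lemma val_mono: "x \<le> y \<Longrightarrow> val x \<le> val y"
  by (rule LIMSEQ_le[OF approx_tendsto approx_tendsto])
    (auto simp: approx_def le_decimal_iff divide_right_mono)

lemma val_max: "val (max x y) = max (val x) (val y)"
  using val_mono[of x y] val_mono[of y x] by (auto simp: max_def)

lemma less_decimal_iff: "x < y \<longleftrightarrow> (\<exists>k. itrunc x k < itrunc y k)"
  using le_decimal_iff[of y x] by (auto simp: not_le[symmetric])

lemma val_less:
  assumes "x < z" "z < y"
  shows "val x < val y"
proof -
  obtain i j where ij: "itrunc x i < itrunc z i" "itrunc z j < itrunc y j"
    using assms by (auto simp: less_decimal_iff)
  define k where "k = max i j"
  have "itrunc x k < itrunc z k" "itrunc z k < itrunc y k"
    using ij itrunc_less_mono[of i k] itrunc_less_mono[of j k] by (simp_all add: k_def)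
  \<comment> \<open>Two strict integer inequalities at one position give a difference of at least 2.
    One unit absorbs the tail of \<open>x\<close>, which may be as large as
    \<open>1 / 10 ^ k\<close>; the other keeps the inequality strict.\<close>
  then have "of_int (itrunc x k) + 1 < (of_int (itrunc y k) :: real)" by linarith
  then have "approx x k + 1 / 10 ^ k < approx y k"
    by (simp add: approx_def divide_strict_right_mono flip: add_divide_distrib)
  then show ?thesis using val_le_approx[of x k] approx_le_val[of y k] by linarith
qed

text \<open>Equality is out of reach here: 0.999... and 1.000... share the value 1.\<close>

lemma no_gap_if_val_eq: "val x = val y \<Longrightarrow> x \<sim> y"
  using val_less unfolding no_gap_def by fastforce

lemma itrunc_decimal_of_rat: "itrunc (decimal_of_rat r) k = \<lfloor>r * 10 ^ k\<rfloor>"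
proof -
  obtain q p where qp: "quotient_of r = (q, p)" by fastforce
  have p: "p > 0" using quotient_of_denom_pos[OF qp] .
  have r: "r = of_int q / of_int p" using quotient_of_div[OF qp] .
  \<comment> \<open>The invariant of long division: the digits so far form the quotient of
    \<open>q * 10 ^ k\<close> by \<open>p\<close>, and \<open>ld_rem\<close> is the
    remainder.\<close>
  have eq: "itrunc (decimal_of_rat r) k * p + ld_rem q p k = q * 10 ^ k"
    by (induction k) (simp_all add: decimal_of_rat.rep_eq qp algebra_simps)
  have rem: "0 \<le> ld_rem q p k" "ld_rem q p k < p" using ld_rem_bounds[OF p] by auto
  have "itrunc (decimal_of_rat r) k = (q * 10 ^ k) div p"
    unfolding eq[symmetric] using rem by (simp add: div_pos_pos_trivial)
  also have "\<dots> = \<lfloor>r * 10 ^ k\<rfloor>"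
    using floor_divide_of_int_eq[of "q * 10 ^ k" p, where 'a = rat] by (simp add: r)
  finally show ?thesis .
qed

lemma decimal_of_rat_mono: "r \<le> s \<Longrightarrow> decimal_of_rat r \<le> decimal_of_rat s"
  by (simp add: le_decimal_iff itrunc_decimal_of_rat floor_mono)

lemma val_decimal_of_rat: "val (decimal_of_rat r) = of_rat r"
proof (rule LIMSEQ_unique[OF approx_tendsto])
  have floor: "approx (decimal_of_rat r) k \<le> of_rat r"
    "of_rat r - (1 / 10) ^ k \<le> approx (decimal_of_rat r) k" for k
  proof -
    have "of_int (itrunc (decimal_of_rat r) k) \<le> r * 10 ^ k"
      "r * 10 ^ k \<le> of_int (itrunc (decimal_of_rat r) k) + 1"
      unfolding itrunc_decimal_of_rat by linarith+
    then have "(of_rat (of_int (itrunc (decimal_of_rat r) k)) :: real) \<le> of_rat (r * 10 ^ k)"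
      "of_rat (r * 10 ^ k) \<le> (of_rat (of_int (itrunc (decimal_of_rat r) k) + 1) :: real)"
      by (simp_all only: of_rat_less_eq)
    then show "approx (decimal_of_rat r) k \<le> of_rat r"
      "of_rat r - (1 / 10) ^ k \<le> approx (decimal_of_rat r) k"
      by (simp_all add: approx_def of_rat_mult of_rat_power of_rat_add power_one_over
          pos_divide_le_eq pos_le_divide_eq left_diff_distrib)
  qed
  have "(\<lambda>k. (1 / 10 :: real) ^ k) \<longlonglongrightarrow> 0" by (rule LIMSEQ_power_zero) simp
  from tendsto_diff[OF tendsto_const this]
  have "(\<lambda>k. of_rat r - (1 / 10) ^ k) \<longlonglongrightarrow> (of_rat r :: real)" by simp
  then show "approx (decimal_of_rat r) \<longlonglongrightarrow> of_rat r"
    by (rule tendsto_sandwich[rotated 2, OF _ tendsto_const]) (simp_all add: floor)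
qed

text \<open>All tails of an increasing sequence have the same supremum, and each tail has its first
  term as infimum, so the upper and lower limits agree.\<close>

lemma LIMIT_incseq:
  assumes "incseq s" and bdd: "bdd_above (range s)"
  shows "LIMIT s = (SUP k\<in>{1..}. s k)"
proof -
  have bdd': "bdd_above (s ` A)" for A
    using bdd by (rule bdd_above_mono) auto
  have tail: "(SUP k\<in>{n..}. s k) = (SUP k\<in>{1..}. s k)" if "n \<ge> 1" for n
  proof (rule antisym)
    show "(SUP k\<in>{n..}. s k) \<le> (SUP k\<in>{1..}. s k)"
      using that by (intro cSUP_subset_mono bdd') auto
    show "(SUP k\<in>{1..}. s k) \<le> (SUP k\<in>{n..}. s k)"
    proof (rule cSUP_mono[OF _ bdd'])
      show "\<exists>m\<in>{n..}. s k \<le> s m" for k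
        using incseqD[OF assms(1), of k "max n k"] by (intro bexI[of _ "max n k"]) auto
    qed auto
  qed
  have "LIMIT_sup s = (INF n\<in>{1::nat..}. SUP k\<in>{1..}. s k)"
    unfolding LIMIT_sup_def by (intro INF_cong refl tail) simp
  then have sup: "LIMIT_sup s = (SUP k\<in>{1..}. s k)" by simp
  have "(INF k\<in>{n..}. s k) = s n" for n
    by (rule cInf_eq_minimum) (use assms(1) in \<open>auto dest: incseqD\<close>)
  then have "LIMIT_inf s = (SUP k\<in>{1..}. s k)"
    by (simp add: LIMIT_inf_def)
  with sup show ?thesis by (simp add: LIMIT_def)
qed

lemma val_LIMIT:
  assumes "incseq s" and lim: "(\<lambda>k. val (s k)) \<longlonglongrightarrow> l"
  shows "val (LIMIT s) = l"
proof -
  have le: "val (s k) \<le> l" for k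
    using incseq_le[OF _ lim] assms(1) val_mono by (simp add: incseq_def)
  \<comment> \<open>Since \<open>val\<close> is monotone but not injective, an inequality of values
    yields one of decimals only when strict. Rationals strictly above \<open>l\<close> therefore
    serve as upper bounds, first for boundedness and then, by density, for
    \<open>val S\<close>.\<close>
  have upper: "s k \<le> decimal_of_rat q" if "l < of_rat q" for k q
  proof (rule ccontr)
    assume "\<not> s k \<le> decimal_of_rat q"
    then have "val (decimal_of_rat q) \<le> val (s k)" by (intro val_mono) simp
    then show False using that le[of k] by (simp add: val_decimal_of_rat)
  qed
  obtain q where "l < of_rat q" using of_rat_dense[of l "l + 1"] by auto
  with upper have bdd: "bdd_above (range s)" by (intro bdd_aboveI2)
  define S where "S = (SUP k\<in>{1..}. s k)"
  have "val S = l"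
  proof (rule antisym)
    show "val S \<le> l"
    proof (rule ccontr)
      assume "\<not> val S \<le> l"
      then obtain q where q: "l < of_rat q" "of_rat q < val S"
        using of_rat_dense[of l "val S"] by auto
      have "S \<le> decimal_of_rat q"
        unfolding S_def by (rule cSUP_least) (use upper q in auto)
      then show False using val_mono[of S] q by (fastforce simp: val_decimal_of_rat)
    qed
    have "s k \<le> S" if "k \<ge> 1" for k
      unfolding S_def using that
      by (intro cSUP_upper bdd_above_mono[OF bdd]) auto
    \<comment> \<open>The supremum ignores index 0, so the terms are compared with it from index 1
      on.\<close>
    then show "l \<le> val S"
      by (intro LIMSEQ_le_const2[OF lim] exI[of _ 1]) (auto intro: val_mono)
  qed
  then show ?thesis by (simp add: LIMIT_incseq[OF assms(1) bdd] S_def)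
qed

lemma incseq_trunc: "incseq (trunc x)"
  using approx_le_Suc by (intro incseq_SucI) (simp flip: of_rat_trunc add: of_rat_less_eq)

lemma val_dadd: "val (x \<oplus> y) = val x + val y"
  unfolding dadd_def
proof (rule val_LIMIT)
  show "incseq (\<lambda>k. decimal_of_rat (trunc x k + trunc y k))"
    using incseq_trunc[of x] incseq_trunc[of y]
    by (auto simp: incseq_def intro!: decimal_of_rat_mono add_mono)
  show "(\<lambda>k. val (decimal_of_rat (trunc x k + trunc y k))) \<longlonglongrightarrow> val x + val y"
    by (simp add: val_decimal_of_rat of_rat_add of_rat_trunc tendsto_add approx_tendsto)
qed

text \<open>Complementing digits to 9 preserves the form -1 - m: 10 * (-1 - m) + (9 - d) = -1 - (10
  * m + d). The extra -1 contributes only \<open>1 / 10 ^ k\<close> and disappears in the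
  limit.\<close>

lemma itrunc_Psi: "itrunc (\<Psi> x) k = - 1 - itrunc x k"
  by (induction k) (simp_all add: Psi.rep_eq)

lemma val_Psi: "val (\<Psi> x) = - val x"
proof (rule LIMSEQ_unique[OF approx_tendsto])
  have "(\<lambda>k. (1 / 10 :: real) ^ k) \<longlonglongrightarrow> 0" by (rule LIMSEQ_power_zero) simp
  from tendsto_diff[OF tendsto_minus[OF approx_tendsto[of x]] this]
  show "approx (\<Psi> x) \<longlonglongrightarrow> - val x"
    by (simp add: approx_def[abs_def] itrunc_Psi power_one_over diff_divide_distrib
        minus_diff_commute)
qed

lemma val_Psi_funpow: "val ((\<Psi> ^^ n) x) = (- 1) ^ n * val x"
  by (induction n) (simp_all add: val_Psi)

lemma val_dabs: "val (dabs x) = \<bar>val x\<bar>"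
  by (simp add: dabs_def val_max val_Psi)

lemma trunc_dabs_nonneg: "0 \<le> trunc (dabs x) k"
proof -
  have "itrunc x k \<le> itrunc (dabs x) k" "itrunc (\<Psi> x) k \<le> itrunc (dabs x) k"
    unfolding dabs_def by (meson le_decimal_iff max.cobounded1 max.cobounded2)+
  \<comment> \<open>The integers m and -1 - m cannot both be negative.\<close>
  then have "0 \<le> itrunc (dabs x) k" by (simp add: itrunc_Psi)
  then show ?thesis by (simp add: trunc_itrunc)
qed

lemma val_dzero: "val dzero = 0"
proof (rule LIMSEQ_unique[OF approx_tendsto])
  have "itrunc dzero k = 0" for k by (induction k) (simp_all add: dzero.rep_eq)
  then show "approx dzero \<longlonglongrightarrow> 0" by (simp add: approx_def[abs_def])
qed

text \<open>The sign of a decimal determines that of its value only weakly: (-1).999... has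
  \<open>dsign\<close> 1 but value 0, where either sign gives the same product.\<close>

lemma dsign_mult_abs_val: "(- 1) ^ dsign x * \<bar>val x\<bar> = val x"
  using val_mono[of dzero x] val_mono[of x dzero] by (auto simp: dsign_def val_dzero)

lemma val_dmult: "val (x \<otimes> y) = val x * val y"
proof -
  have "val (LIMIT (\<lambda>k. decimal_of_rat (trunc (dabs x) k * trunc (dabs y) k)))
      = val (dabs x) * val (dabs y)"
  proof (rule val_LIMIT)
    \<comment> \<open>Nonnegativity of the truncations of absolute values is what makes their
      products increase.\<close>
    show "incseq (\<lambda>k. decimal_of_rat (trunc (dabs x) k * trunc (dabs y) k))"
      using incseq_trunc[of "dabs x"] incseq_trunc[of "dabs y"]
      by (auto simp: incseq_def trunc_dabs_nonneg intro!: decimal_of_rat_mono mult_mono)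
    show "(\<lambda>k. val (decimal_of_rat (trunc (dabs x) k * trunc (dabs y) k)))
        \<longlonglongrightarrow> val (dabs x) * val (dabs y)"
      by (simp add: val_decimal_of_rat of_rat_mult of_rat_trunc tendsto_mult approx_tendsto)
  qed
  then have "val (x \<otimes> y) = ((- 1) ^ dsign x * \<bar>val x\<bar>) * ((- 1) ^ dsign y * \<bar>val y\<bar>)"
    by (simp add: dmult_def val_Psi_funpow val_dabs power_add)
  then show ?thesis by (simp only: dsign_mult_abs_val)
qed

theorem theorem4p11:
  fixes x y z :: decimal
  shows "(x \<oplus> y) \<otimes> z \<sim> (x \<otimes> z) \<oplus> (y \<otimes> z)"
  by (rule no_gap_if_val_eq) (simp add: val_dadd val_dmult distrib_right)

end
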